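(* Let $X_1,X_2,\dots$ be i.i.d. real-valued continuous random variables. For $r>0$ and $n\ge1$ the following hold, where $f(x)=(x+\alpha)^p$ and $M^f_n=\left(\frac1n\sum_{j=1}^n (X_j+\alpha)^p\right)^{1/p}-\alpha$. (i) Let $p\in(-1,0)$ and $\alpha\in\overline{\mathbb{H}}$, and let $X_1\in L^{r/n}$. Then $M^f_n\in L^r$. (ii) Let $p=-1$ and $\alpha\in\mathbb{H}$, and let $X_1\in L^{2r/n}$. Then $M^f_n\in L^r$.
   Context: $\mathbb{H}=\{z\in\mathbb{C}:\mathrm{Im}(z)>0\}$ and $\overline{\mathbb{H}}=\{z\in\mathbb{C}:\mathrm{Im}(z)\ge0\}$. Complex powers use the principal branch: $z^q=\exp(q\log z)$ with $\log z=\log r+i\theta$ for $z=r e^{i\theta}$, $r>0$, $\theta\in(-\pi,\pi]$. For $s>0$, a complex-valued random variable $Y$ is in $L^s$ if $E[|Y|^s]<+\infty$. "Continuous" random variable means that its distribution function is continuous, i.e. $P(X_1=x)=0$ for every $x\in\mathbb{R}$. In general $M_n^f:=f^{-1}\left(\frac1n\sum_{j=1}^n f(X_j)\right)$; for the present $f$, this is the displayed formula, almost surely well defined. *)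

theory Defs
  imports "HOL-Probability.Probability"
begin

definition in_Lspace :: "'a measure \<Rightarrow> real \<Rightarrow> ('a \<Rightarrow> 'b::real_normed_vector) \<Rightarrow> bool"
  where "in_Lspace M s Y \<longleftrightarrow>
    Y \<in> borel_measurable M \<and> integrable M (\<lambda>\<omega>. norm (Y \<omega>) powr s)"

definition iid_seq :: "'a measure \<Rightarrow> (nat \<Rightarrow> 'a \<Rightarrow> real) \<Rightarrow> bool"
  where "iid_seq M X \<longleftrightarrow>
    prob_space.indep_vars M (\<lambda>_. borel) X {1..} \<and>
    (\<forall>j\<ge>1. distr M borel (X j) = distr M borel (X 1))"

text \<open>Continuity of the distribution function, not existence of a density.\<close>

definition continuous_rv :: "'a measure \<Rightarrow> ('a \<Rightarrow> real) \<Rightarrow> bool"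
  where "continuous_rv M Y \<longleftrightarrow>
    Y \<in> borel_measurable M \<and> continuous_on UNIV (cdf (distr M borel Y))"

text \<open>
  On type \<^typ>\<open>complex\<close>, \<open>powr\<close> is the principal branch (argument in \<open>(-\<pi>, \<pi>]\<close>), totalised
  by \<open>0 powr q = 0\<close>. For the parameters of interest, a base is zero only on a null event.
\<close>

definition shifted_power :: "real \<Rightarrow> complex \<Rightarrow> real \<Rightarrow> complex"
  where "shifted_power p \<alpha> x = (complex_of_real x + \<alpha>) powr complex_of_real p"

definition power_mean ::
    "real \<Rightarrow> complex \<Rightarrow> (nat \<Rightarrow> 'a \<Rightarrow> real) \<Rightarrow> nat \<Rightarrow> 'a \<Rightarrow> complex"
  where "power_mean p \<alpha> X n \<omega> =
    (1 / of_nat n * (\<Sum>j=1..n. shifted_power p \<alpha> (X j \<omega>))) powr complex_of_real (1 / p) - \<alpha>"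

end

theory Submission
  imports Defs "HOL-Complex_Analysis.Cauchy_Integral_Theorem"
begin

text \<open>
  Write \<open>w\<^sub>j = X\<^sub>j + \<alpha>\<close>, a point of the closed upper half-plane that is almost surely nonzero because
  \<open>X\<^sub>j\<close> has no atoms. In both cases the numbers \<open>w\<^sub>j\<^sup>p\<close> lie in a common half-plane: after one rotation
  \<open>\<zeta>\<close> their real parts are at least \<open>c |w\<^sub>j|\<^bsup>-q\<^esup>\<close> with \<open>c > 0\<close>. For \<open>-1 < p < 0\<close> the arguments fill
  a sector of opening \<open>|p|\<pi> < \<pi>\<close>, so \<open>q = -p\<close> works; for \<open>p = -1\<close> the sector is a full half-plane and
  only the height \<open>Im \<alpha>\<close> of the points \<open>w\<^sub>j\<close> above the real axis is left, which gives \<open>q = 2\<close> (this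
  is where the doubled moment comes from).

  Hence no cancellation occurs in the sum, and the inequality of arithmetic and geometric means gives
  \<open>|n\<^sup>-\<^sup>1 \<Sum> w\<^sub>j\<^sup>p| \<ge> c (\<Prod> |w\<^sub>j|)\<^bsup>-q/n\<^esup>\<close>. Raising to the negative power \<open>1/p\<close> turns this lower bound into
  \<open>|M\<^sub>n + \<alpha>| \<le> c\<^bsup>1/p\<^esup> \<Prod> |w\<^sub>j|\<^bsup>-q/(pn)\<^esup>\<close> (\<open>norm_powr_mean_le_prod\<close>). The point of passing to the
  geometric mean is that the bound is a product of independent factors: its \<open>r\<close>-th moment is the
  product of the moments of \<open>|w\<^sub>j|\<close> of order \<open>-qr/(pn)\<close>, that is, \<open>r/n\<close> in the first case and
  \<open>2r/n\<close> in the second (\<open>in_Lspace_power_mean\<close>).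
\<close>

section \<open>Spaces of random variables with finite moments\<close>

lemma norm_add_powr_le:
  fixes x y :: "'b::real_normed_vector"
  assumes "s \<ge> 0"
  shows "norm (x + y) powr s \<le> 2 powr s * (norm x powr s + norm y powr s)"
proof -
  have "norm (x + y) \<le> 2 * max (norm x) (norm y)"
    using norm_triangle_ineq[of x y] by linarith
  then have "norm (x + y) powr s \<le> (2 * max (norm x) (norm y)) powr s"
    using assms by (intro powr_mono2) auto
  also have "\<dots> = 2 powr s * max (norm x) (norm y) powr s"
    by (simp add: powr_mult)
  also have "max (norm x) (norm y) powr s \<le> norm x powr s + norm y powr s"
    by (simp add: max_def)
  finally show ?thesis by simp
qed

lemma (in finite_measure) in_Lspace_add_const:
  fixes Y :: "'a \<Rightarrow> complex"
  assumes "in_Lspace M s Y" "s \<ge> 0"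
  shows "in_Lspace M s (\<lambda>\<omega>. Y \<omega> + c)"
proof -
  have Y[measurable]: "Y \<in> borel_measurable M"
    and int: "integrable M (\<lambda>\<omega>. norm (Y \<omega>) powr s)"
    using assms by (auto simp: in_Lspace_def)
  have "integrable M (\<lambda>\<omega>. 2 powr s * (norm (Y \<omega>) powr s + norm c powr s))"
    using int by simp
  then have "integrable M (\<lambda>\<omega>. norm (Y \<omega> + c) powr s)"
    by (rule Bochner_Integration.integrable_bound)
      (auto intro!: norm_add_powr_le[OF assms(2)] order_trans[OF _ abs_ge_self])
  then show ?thesis by (simp add: in_Lspace_def)
qed

section \<open>Power means of points whose powers lie in a half-plane\<close>

lemma norm_powr_complex_of_real: "norm (z powr complex_of_real a) = norm z powr a"
  by (simp add: powr_def)

text \<open>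
  In the application \<open>u i\<close> is the \<open>p\<close>-th power of \<open>w i\<close>. Projecting the mean of the \<open>u i\<close>
  on the direction \<open>cnj \<zeta>\<close> bounds its modulus from below by an arithmetic mean of positive numbers, hence by their geometric mean; the negative exponent reverses the inequality.
\<close>

lemma norm_powr_mean_le_prod:
  fixes u w :: "'i \<Rightarrow> complex"
  assumes I: "finite I" "I \<noteq> {}"
    and w: "\<And>i. i \<in> I \<Longrightarrow> w i \<noteq> 0"
    and "p < 0" "c > 0" "norm \<zeta> = 1"
    and u: "\<And>i. i \<in> I \<Longrightarrow> c * norm (w i) powr (-q) \<le> Re (\<zeta> * u i)"
  shows "norm ((1 / of_nat (card I) * (\<Sum>i\<in>I. u i)) powr complex_of_real (1 / p))
    \<le> c powr (1 / p) * (\<Prod>i\<in>I. norm (w i) powr (-q / p / card I))"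
proof -
  define n where "n = card I"
  have "n > 0" using I by (simp add: n_def card_gt_0_iff)
  define P where "P = (\<Prod>i\<in>I. norm (w i) powr (-q))"
  have P: "P > 0" unfolding P_def using w by (intro prod_pos) simp
  let ?m = "1 / of_nat n * (\<Sum>i\<in>I. u i)"
  have "c * P powr (1 / n) \<le> c * (\<Sum>i\<in>I. norm (w i) powr (-q) / n)"
    unfolding P_def n_def using I \<open>c > 0\<close> by (intro mult_left_mono arith_geom_mean) auto
  also have "\<dots> = (\<Sum>i\<in>I. c * norm (w i) powr (-q)) / n"
    by (simp add: sum_distrib_left sum_divide_distrib)
  also have "\<dots> \<le> (\<Sum>i\<in>I. Re (\<zeta> * u i)) / n"
    using u by (intro divide_right_mono sum_mono) auto
  also have "\<dots> = Re (\<zeta> * (\<Sum>i\<in>I. u i) / of_nat n)"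
    by (simp add: sum_distrib_left)
  also have "\<zeta> * (\<Sum>i\<in>I. u i) / of_nat n = \<zeta> * ?m" by simp
  also have "Re (\<zeta> * ?m) \<le> norm (\<zeta> * ?m)" by (rule complex_Re_le_cmod)
  also have "\<dots> = norm ?m" unfolding norm_mult[of \<zeta>] by (simp only: \<open>norm \<zeta> = 1\<close> mult_1_left)
  finally have lower: "c * P powr (1 / n) \<le> norm ?m" .
  have "norm ?m powr (1 / p) \<le> (c * P powr (1 / n)) powr (1 / p)"
    using lower \<open>c > 0\<close> P \<open>p < 0\<close> by (intro powr_mono2') auto
  also have "\<dots> = c powr (1 / p) * P powr (1 / n / p)"
    using \<open>c > 0\<close> by (simp add: powr_mult powr_powr)
  also have "P powr (1 / n / p) = (\<Prod>i\<in>I. norm (w i) powr (-q / p / n))"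
    unfolding P_def by (simp add: prod_powr_distrib powr_powr field_simps)
  finally show ?thesis
    unfolding norm_powr_complex_of_real n_def .
qed

text \<open>
  The argument of \<open>z powr p\<close> is \<open>p\<close> times an angle in \<open>[0, \<pi>]\<close>; the rotation by \<open>-p\<pi>/2\<close> centres
  this sector at the positive real axis, where the cosine of the deviation is at least \<open>cos (p\<pi>/2)\<close>.
\<close>

lemma Re_rotated_powr_ge:
  assumes "Im z \<ge> 0" "z \<noteq> 0" "\<bar>p\<bar> \<le> 1"
  shows "cos (p * pi / 2) * norm z powr p \<le> Re (cis (- (p * pi / 2)) * z powr complex_of_real p)"
proof -
  have Ln: "0 \<le> Im (Ln z)" "Im (Ln z) \<le> pi"
    using assms Im_Ln_pos_le by auto
  have "\<bar>p * (Im (Ln z) - pi / 2)\<bar> \<le> \<bar>p\<bar> * (pi / 2)"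
    unfolding abs_mult using Ln by (intro mult_left_mono) (auto simp: abs_if)
  moreover have "\<bar>p\<bar> * (pi / 2) \<le> pi"
    using mult_right_mono[OF assms(3), of "pi / 2"] pi_gt_zero by linarith
  ultimately have "cos (\<bar>p\<bar> * (pi / 2)) \<le> cos \<bar>p * (Im (Ln z) - pi / 2)\<bar>"
    by (intro cos_monotone_0_pi_le) auto
  moreover have "cos (\<bar>p\<bar> * (pi / 2)) = cos (p * pi / 2)"
    by (simp add: abs_if)
  ultimately have "cos (p * pi / 2) \<le> cos (p * (Im (Ln z) - pi / 2))"
    by simp
  then have "cos (p * pi / 2) * norm z powr p \<le> cos (p * (Im (Ln z) - pi / 2)) * norm z powr p"
    by (intro mult_right_mono) auto
  also have "\<dots> = Re (exp (\<i> * of_real (- (p * pi / 2)) + complex_of_real p * Ln z))"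
    using assms by (simp add: Re_exp powr_def algebra_simps)
  also have "exp (\<i> * of_real (- (p * pi / 2)) + complex_of_real p * Ln z)
      = cis (- (p * pi / 2)) * z powr complex_of_real p"
    using assms by (simp only: exp_add powr_def cis_conv_exp if_False)
  finally show ?thesis .
qed

section \<open>Moments of the power mean\<close>

context prob_space
begin

lemma AE_neq_if_continuous_rv:
  assumes "continuous_rv M Y"
  shows "AE \<omega> in M. Y \<omega> \<noteq> x"
proof -
  have Y[measurable]: "Y \<in> borel_measurable M"
    and cont: "isCont (cdf (distr M borel Y)) x"
    using assms by (auto simp: continuous_rv_def continuous_on_eq_continuous_at)
  interpret D: real_distribution "distr M borel Y"
    by (rule real_distribution_distr) simp
  have "measure (distr M borel Y) {x} = 0"
    using cont by (simp add: D.isCont_cdf)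
  then have "AE y in distr M borel Y. y \<noteq> x"
    by (intro D.prob_eq_0[THEN iffD1, of "{x}", simplified]) auto
  then show ?thesis by (subst (asm) AE_distr_iff) auto
qed

lemma in_Lspace_iid:
  assumes "iid_seq M X" "in_Lspace M s (X 1)" "j \<ge> 1"
  shows "in_Lspace M s (X j)"
proof -
  have meas: "X i \<in> borel_measurable M" if "i \<ge> 1" for i
    using assms(1) that by (auto simp: iid_seq_def indep_vars_def)
  have transfer: "integrable M (\<lambda>\<omega>. norm (X i \<omega>) powr s)
      \<longleftrightarrow> integrable (distr M borel (X i)) (\<lambda>x. norm x powr s)" if "i \<ge> 1" for i
    by (rule integrable_distr_eq[symmetric]) (use meas[OF that] in measurable)
  have "distr M borel (X j) = distr M borel (X 1)"
    using assms(1,3) unfolding iid_seq_def by blast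
  then show ?thesis
    using assms(2) transfer[OF assms(3)] transfer[OF order_refl] meas[OF assms(3)]
    unfolding in_Lspace_def by metis
qed

text \<open>
  The \<open>r\<close>-th power of the product bound has the factors \<open>|w\<^sub>j|\<close> to the power \<open>-qr/(pn)\<close>, which
  determines the moment of \<open>X 1\<close> to be assumed. Independence then makes the product integrable.
\<close>

lemma in_Lspace_power_mean:
  assumes iid: "iid_seq M X" and cont: "\<And>j. j \<ge> 1 \<Longrightarrow> continuous_rv M (X j)"
    and "r > 0" "n \<ge> 1" "p < 0" "q > 0" "c > 0" "norm \<zeta> = 1"
    and half_plane: "\<And>x. complex_of_real x + \<alpha> \<noteq> 0 \<Longrightarrow>
      c * norm (complex_of_real x + \<alpha>) powr (-q) \<le> Re (\<zeta> * shifted_power p \<alpha> x)"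
    and moment: "in_Lspace M (-q / p * r / n) (X 1)"
  shows "in_Lspace M r (power_mean p \<alpha> X n)"
proof -
  define w where "w j \<omega> = complex_of_real (X j \<omega>) + \<alpha>" for j \<omega>
  define s where "s = -q / p * r / n"
  have "s \<ge> 0"
    unfolding s_def using assms(3-6) divide_nonpos_neg[of "- q" p]
    by (intro divide_nonneg_nonneg[of _ "real n"] mult_nonneg_nonneg) simp_all
  have X[measurable]: "X j \<in> borel_measurable M" if "j \<in> {1..n}" for j
    using iid that by (auto simp: iid_seq_def indep_vars_def)
  define G where "G \<omega> = (1 / of_nat n * (\<Sum>j=1..n. shifted_power p \<alpha> (X j \<omega>)))
      powr complex_of_real (1 / p)" for \<omega>
  have G[measurable]: "G \<in> borel_measurable M"
    unfolding G_def shifted_power_def by measurable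

  have w_int: "integrable M (\<lambda>\<omega>. norm (w j \<omega>) powr s)" if "j \<in> {1..n}" for j
  proof -
    have "in_Lspace M s (X j)"
      using in_Lspace_iid[OF iid moment] that by (simp add: s_def)
    then have "in_Lspace M s (\<lambda>\<omega>. complex_of_real (X j \<omega>))"
      using X[OF that] by (simp add: in_Lspace_def)
    from in_Lspace_add_const[OF this \<open>s \<ge> 0\<close>, of \<alpha>] show ?thesis
      by (simp add: in_Lspace_def w_def)
  qed
  have "indep_vars (\<lambda>_. borel) X {1..n}"
    using iid by (auto simp: iid_seq_def intro: indep_vars_subset)
  then have "indep_vars (\<lambda>_. borel) (\<lambda>j \<omega>. norm (w j \<omega>) powr s) {1..n}"
    unfolding w_def by (rule indep_vars_compose2) measurable
  then have prod_int: "integrable M (\<lambda>\<omega>. \<Prod>j=1..n. norm (w j \<omega>) powr s)"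
    using w_int by (intro indep_vars_integrable) auto

  \<comment> \<open>Where some \<open>w j \<omega>\<close> vanishes, the product bound is \<open>0\<close>, but by \<open>0 powr p = 0\<close> the remaining terms
    of the sum may still give a nonzero mean; so these points have to form a null set.\<close>
  have "AE \<omega> in M. \<forall>j\<in>{1..n}. w j \<omega> \<noteq> 0"
  proof (rule AE_finite_allI)
    fix j assume "j \<in> {1..n}"
    then have "AE \<omega> in M. X j \<omega> \<noteq> - Re \<alpha>"
      using cont by (intro AE_neq_if_continuous_rv) auto
    then show "AE \<omega> in M. w j \<omega> \<noteq> 0"
      by eventually_elim (auto simp: w_def complex_eq_iff)
  qed simp
  then have bound: "AE \<omega> in M. norm (G \<omega>) powr r
      \<le> (c powr (1 / p)) powr r * (\<Prod>j=1..n. norm (w j \<omega>) powr s)"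
  proof eventually_elim
    case (elim \<omega>)
    have "norm (G \<omega>) \<le> c powr (1 / p) * (\<Prod>j=1..n. norm (w j \<omega>) powr (-q / p / n))"
      using norm_powr_mean_le_prod[of "{1..n}" "\<lambda>j. w j \<omega>" p c \<zeta> q "\<lambda>j. shifted_power p \<alpha> (X j \<omega>)"]
        elim half_plane assms(4-8) by (simp add: G_def w_def)
    then have "norm (G \<omega>) powr r \<le> (c powr (1 / p) * (\<Prod>j=1..n. norm (w j \<omega>) powr (-q / p / n))) powr r"
      using \<open>r > 0\<close> by (intro powr_mono2) auto
    also have "\<dots> = (c powr (1 / p)) powr r * (\<Prod>j=1..n. norm (w j \<omega>) powr s)"
      by (simp add: powr_mult prod_nonneg prod_powr_distrib powr_powr s_def)
    finally show ?case .
  qed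
  have "integrable M (\<lambda>\<omega>. (c powr (1 / p)) powr r * (\<Prod>j=1..n. norm (w j \<omega>) powr s))"
    using prod_int by simp
  then have "integrable M (\<lambda>\<omega>. norm (G \<omega>) powr r)"
  proof (rule Bochner_Integration.integrable_bound)
    show "AE \<omega> in M. norm (norm (G \<omega>) powr r)
        \<le> norm ((c powr (1 / p)) powr r * (\<Prod>j=1..n. norm (w j \<omega>) powr s))"
      using bound by eventually_elim auto
  qed measurable
  then have "in_Lspace M r (\<lambda>\<omega>. G \<omega> + - \<alpha>)"
    using \<open>r > 0\<close> by (intro in_Lspace_add_const) (auto simp: in_Lspace_def)
  then show ?thesis
    by (simp add: power_mean_def[abs_def] G_def[abs_def])
qed

end

theorem theorem4p1:
  fixes M :: "'a measure" and X :: "nat \<Rightarrow> 'a \<Rightarrow> real" and r :: real and n :: nat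
  assumes "prob_space M"
    and "iid_seq M X"
    and "\<And>j. j \<ge> 1 \<Longrightarrow> continuous_rv M (X j)"
    and "r > 0" and "n \<ge> 1"
  shows "(\<forall>(p::real) (\<alpha>::complex). -1 < p \<and> p < 0 \<and> Im \<alpha> \<ge> 0 \<and> in_Lspace M (r / real n) (X 1)
            \<longrightarrow> in_Lspace M r (power_mean p \<alpha> X n))
       \<and> (\<forall>(p::real) (\<alpha>::complex). p = -1 \<and> Im \<alpha> > 0 \<and> in_Lspace M (2 * r / real n) (X 1)
            \<longrightarrow> in_Lspace M r (power_mean p \<alpha> X n))"
proof -
  interpret prob_space M by fact
  note mean = in_Lspace_power_mean[OF assms(2,3,4,5)]
  have "in_Lspace M r (power_mean p \<alpha> X n)"
    if p: "-1 < p" "p < 0" and "Im \<alpha> \<ge> 0" and X: "in_Lspace M (r / real n) (X 1)"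
    for p :: real and \<alpha> :: complex
  proof (rule mean[where q = "- p" and c = "cos (p * pi / 2)" and \<zeta> = "cis (- (p * pi / 2))"])
    have "\<bar>p * pi / 2\<bar> < pi / 2"
      using p mult_strict_right_mono[of "- p" 1 pi] by (simp add: abs_mult)
    then show "cos (p * pi / 2) > 0"
      by (intro cos_gt_zero_pi) (simp_all only: abs_less_iff, linarith+)
    show "in_Lspace M (- (- p) / p * r / real n) (X 1)"
      using X p by simp
    show "cos (p * pi / 2) * norm (complex_of_real x + \<alpha>) powr (- (- p))
        \<le> Re (cis (- (p * pi / 2)) * shifted_power p \<alpha> x)"
      if "complex_of_real x + \<alpha> \<noteq> 0" for x
      using Re_rotated_powr_ge[of "complex_of_real x + \<alpha>" p] that p \<open>Im \<alpha> \<ge> 0\<close>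
      by (simp add: shifted_power_def)
    show "norm (cis (- (p * pi / 2))) = 1"
      by (rule norm_cis)
  qed (use p in simp_all)
  moreover have "in_Lspace M r (power_mean (-1) \<alpha> X n)"
    if "Im \<alpha> > 0" and X: "in_Lspace M (2 * r / real n) (X 1)" for \<alpha> :: complex
  proof (rule mean[where q = 2 and c = "Im \<alpha>" and \<zeta> = \<i>])
    show "in_Lspace M (- 2 / - 1 * r / real n) (X 1)"
      using X by simp
    show "Im \<alpha> * norm (complex_of_real x + \<alpha>) powr (- 2) \<le> Re (\<i> * shifted_power (-1) \<alpha> x)"
      if nz: "complex_of_real x + \<alpha> \<noteq> 0" for x
    proof -
      let ?w = "complex_of_real x + \<alpha>"
      have "shifted_power (-1) \<alpha> x = inverse ?w"
        using nz by (simp add: shifted_power_def powr_minus)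
      \<comment> \<open>Multiplication by \<open>\<i>\<close> turns \<open>-Im (1 / w) = Im w / |w|\<^sup>2\<close> into a real part.\<close>
      moreover have "Re (\<i> * inverse ?w) = Im \<alpha> / (norm ?w)\<^sup>2"
        by (simp add: cmod_power2)
      moreover have "norm ?w powr (- 2) = 1 / (norm ?w)\<^sup>2"
        using nz by (simp add: powr_minus_divide)
      ultimately show ?thesis
        by (simp only: times_divide_eq_right mult_1_right order_refl)
    qed
  qed (use that in simp_all)
  ultimately show ?thesis by blast
qed

end
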